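(* Let $p$ be a prime and $k\ge 0$ an integer. The characteristic polynomial of the binomial sequence $\left\{\binom{n}{k}\right\}_{n\ge 0}$ modulo $p$ is $(x-1)^{k+1}\in\mathbb{F}_p[x]$. Hence its linear complexity is $k+1$.
   Context: The $k$-th ($p$-ary) binomial sequence $\left\{\binom{n}{k}\right\}_{n\ge0}$ is the sequence over $\mathbb{F}_p$ with $n$-th term $\binom{n}{k}\bmod p$, with $\binom{n}{k}=0$ for $n<k$. Let $E$ denote the shift operator, $E s_n=s_{n+1}$. A polynomial $q(x)=\sum_i a_i x^i\in\mathbb{F}_p[x]$ generates a sequence $\{s_n\}_{n\ge0}$ over $\mathbb{F}_p$ if $q(E)s_n=\sum_i a_i s_{n+i}=0$ for all $n\ge 0$. The set of generating polynomials is an ideal of $\mathbb{F}_p[x]$; when it is nonzero, its unique monic element of lowest degree is called the characteristic polynomial of the sequence. The linear complexity is the degree of the characteristic polynomial. *)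

theory Defs
  imports "Berlekamp_Zassenhaus.Finite_Field"
begin

text \<open>
  The field with p elements is \<open>'p mod_ring\<close>, where p is \<open>CARD('p)\<close>; the type class
  \<open>prime_card\<close> states exactly that this number is prime.
\<close>

definition binomial_seq :: "nat \<Rightarrow> nat \<Rightarrow> 'p::prime_card mod_ring" where
  "binomial_seq k n = of_nat (n choose k)"

text \<open>The value q(E) s of a polynomial in the shift operator E at a sequence s.\<close>

definition shift_eval :: "'a::comm_ring_1 poly \<Rightarrow> (nat \<Rightarrow> 'a) \<Rightarrow> nat \<Rightarrow> 'a" where
  "shift_eval q s n = (\<Sum>i\<le>degree q. coeff q i * s (n + i))"

definition generating_polys :: "(nat \<Rightarrow> 'a::comm_ring_1) \<Rightarrow> 'a poly set" where
  "generating_polys s = {q. \<forall>n. shift_eval q s n = 0}"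

definition is_characteristic_poly :: "(nat \<Rightarrow> 'a::field) \<Rightarrow> 'a poly \<Rightarrow> bool" where
  "is_characteristic_poly s q \<longleftrightarrow>
     q \<in> generating_polys s \<and> lead_coeff q = 1 \<and>
     (\<forall>r\<in>generating_polys s. r \<noteq> 0 \<longrightarrow> degree q \<le> degree r)"

text \<open>
  The next two notions are meaningful only if \<open>generating_polys s \<noteq> {0}\<close>;
  see \<open>ex1_characteristic_poly\<close> below.
\<close>

definition characteristic_poly :: "(nat \<Rightarrow> 'a::field) \<Rightarrow> 'a poly" where
  "characteristic_poly s = (THE q. is_characteristic_poly s q)"

definition linear_complexity :: "(nat \<Rightarrow> 'a::field) \<Rightarrow> nat" where
  "linear_complexity s = degree (characteristic_poly s)"

lemma shift_eval_bound:
  assumes "degree q \<le> N"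
  shows "shift_eval q s n = (\<Sum>i\<le>N. coeff q i * s (n + i))"
  unfolding shift_eval_def
  by (rule sum.mono_neutral_left) (use assms in \<open>auto simp: coeff_eq_0\<close>)

lemma shift_eval_0 [simp]: "shift_eval 0 s n = 0"
  by (simp add: shift_eval_def)

lemma zero_in_generating_polys [simp]: "0 \<in> generating_polys s"
  by (simp add: generating_polys_def)

lemma shift_eval_diff: "shift_eval (q - r) s n = shift_eval q s n - shift_eval r s n"
proof -
  define N where "N = max (degree q) (degree r)"
  have "degree (q - r) \<le> N" "degree q \<le> N" "degree r \<le> N"
    by (auto simp: N_def degree_diff_le_max)
  then show ?thesis
    by (simp add: shift_eval_bound sum_subtractf left_diff_distrib)
qed

lemma shift_eval_smult: "shift_eval (smult c q) s n = c * shift_eval q s n"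
  by (subst shift_eval_bound[OF degree_smult_le])
    (simp add: shift_eval_def sum_distrib_left mult.assoc)

lemma shift_eval_pCons: "shift_eval (pCons c q) s n = c * s n + shift_eval q s (Suc n)"
proof -
  have "shift_eval (pCons c q) s n = (\<Sum>i\<le>Suc (degree q). coeff (pCons c q) i * s (n + i))"
    by (rule shift_eval_bound) (rule degree_pCons_le)
  also have "\<dots> = c * s n + shift_eval q s (Suc n)"
    by (simp only: sum.atMost_Suc_shift) (simp add: shift_eval_def)
  finally show ?thesis .
qed

lemma shift_eval_add: "shift_eval (q + r) s n = shift_eval q s n + shift_eval r s n"
  using shift_eval_diff[of "q + r" r s n] by simp

lemma mult_in_generating_polys:
  assumes "q \<in> generating_polys s"
  shows "r * q \<in> generating_polys s"
proof (induction r)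
  case (pCons a r)
  then show ?case
    using assms
    by (simp add: generating_polys_def shift_eval_add shift_eval_smult
        shift_eval_pCons)
qed simp

lemma ex1_characteristic_poly:
  fixes s :: "nat \<Rightarrow> 'a::field"
  assumes "generating_polys s \<noteq> {0}"
  shows "\<exists>!q. is_characteristic_poly s q"
proof -
  have "\<exists>r. r \<in> generating_polys s \<and> r \<noteq> 0"
    using assms zero_in_generating_polys[of s] by fast
  then obtain r where r: "r \<in> generating_polys s" "r \<noteq> 0"
    and least: "\<And>t. t \<in> generating_polys s \<Longrightarrow> t \<noteq> 0 \<Longrightarrow> degree r \<le> degree t"
    using exists_least_iff[of "\<lambda>d. \<exists>r. r \<in> generating_polys s \<and> r \<noteq> 0 \<and> degree r = d"]
    by (metis not_less)
  have "smult (inverse (lead_coeff r)) r \<in> generating_polys s"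
    using r by (simp add: generating_polys_def shift_eval_smult)
  then have "is_characteristic_poly s (smult (inverse (lead_coeff r)) r)"
    using r least by (simp add: is_characteristic_poly_def)
  moreover have "q = t" if q: "is_characteristic_poly s q" and t: "is_characteristic_poly s t" for q t
  proof (rule ccontr)
    assume "q \<noteq> t"
    have deg: "degree q = degree t"
      using q t unfolding is_characteristic_poly_def
      by (metis antisym leading_coeff_0_iff zero_neq_one)
    have gen: "q - t \<in> generating_polys s"
      using q t by (simp add: is_characteristic_poly_def generating_polys_def shift_eval_diff)
    have le: "degree q \<le> degree (q - t)"
      using q gen \<open>q \<noteq> t\<close> by (simp add: is_characteristic_poly_def)
    have "degree (q - t) \<le> degree q"
      using degree_diff_le_max[of q t] deg by simp
    with le have "degree (q - t) = degree q"
      by simp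
    moreover have "coeff q (degree q) = 1" "coeff t (degree q) = 1"
      using q t deg by (simp_all add: is_characteristic_poly_def)
    ultimately have "lead_coeff (q - t) = 0"
      by simp
    then have "q - t = 0"
      by (simp only: leading_coeff_0_iff)
    with \<open>q \<noteq> t\<close> show False
      by simp
  qed
  ultimately show ?thesis
    by blast
qed

end

theory Submission
  imports Defs
begin

text \<open>
  As an operator, \<open>E - 1\<close> is the difference operator, and by Pascal's rule it sends the
  \<open>(k+1)\<close>-st binomial sequence to the \<open>k\<close>-th, hence \<open>(E - 1)\<^sup>k\<^sup>+\<^sup>1\<close> annihilates the \<open>k\<close>-th.
  Conversely, the \<open>k\<close>-th sequence starts with \<open>k\<close> zeros followed by a one, so a generating
  polynomial of degree \<open>d \<le> k\<close>, applied at position \<open>k - d\<close>, would give its leading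
  coefficient, which would have to vanish.
\<close>

text \<open>Polynomials in \<open>E\<close> commute, so a factor \<open>x - 1\<close> can be moved
  onto the sequence; this lets the induction on \<open>k\<close> peel off one factor at a
  time.\<close>

lemma shift_eval_difference:
  "shift_eval ([:-1, 1:] * q) s n = shift_eval q (\<lambda>n. s (Suc n) - s n) n"
proof -
  have "shift_eval ([:-1, 1:] * q) s n = shift_eval q s (Suc n) - shift_eval q s n"
    by (simp add: shift_eval_add shift_eval_diff shift_eval_pCons flip: minus_add_distrib)
  also have "\<dots> = shift_eval q (\<lambda>n. s (Suc n) - s n) n"
    by (simp add: shift_eval_def right_diff_distrib sum_subtractf)
  finally show ?thesis .
qed

lemma binomial_seq_difference_0:
  "binomial_seq 0 (Suc n) - binomial_seq 0 n = 0"
  by (simp add: binomial_seq_def)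

lemma binomial_seq_difference_Suc:
  "binomial_seq (Suc k) (Suc n) - binomial_seq (Suc k) n = binomial_seq k n"
  by (simp add: binomial_seq_def)

lemma power_in_generating_polys_binomial_seq:
  "[:-1, 1:] ^ (k + 1) \<in> generating_polys (binomial_seq k :: nat \<Rightarrow> 'p::prime_card mod_ring)"
proof (induction k)
  case 0
  \<comment> \<open>The cofactor \<open>1\<close> gives the product form that
    \<open>shift_eval_difference\<close> rewrites.\<close>
  have "shift_eval ([:-1, 1:] * 1) (binomial_seq 0 :: nat \<Rightarrow> 'p mod_ring) n = 0" for n
    unfolding shift_eval_difference binomial_seq_difference_0
    by (simp add: shift_eval_def)
  then show ?case
    by (simp add: generating_polys_def)
next
  case (Suc k)
  have "shift_eval ([:-1, 1:] * [:-1, 1:] ^ (k + 1))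
      (binomial_seq (Suc k) :: nat \<Rightarrow> 'p mod_ring) n = 0" for n
    unfolding shift_eval_difference binomial_seq_difference_Suc
    using Suc.IH by (simp add: generating_polys_def)
  then show ?case
    by (simp add: generating_polys_def)
qed

lemma degree_generating_poly_binomial_seq:
  assumes "r \<in> generating_polys (binomial_seq k)" "r \<noteq> 0"
  shows "k < degree r"
proof (rule ccontr)
  assume "\<not> k < degree r"
  then have le: "degree r \<le> k"
    by simp
  \<comment> \<open>By \<open>le\<close> the subtraction is not truncated, so the index
    \<open>k - degree r + i\<close> reaches \<open>k\<close> exactly at
    \<open>i = degree r\<close>.\<close>
  have "shift_eval r (binomial_seq k) (k - degree r) =
      (\<Sum>i\<le>degree r. if i = degree r then lead_coeff r else 0)"
    unfolding shift_eval_def using le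
    by (intro sum.cong) (auto simp: binomial_seq_def binomial_eq_0)
  with assms show False
    by (simp add: generating_polys_def)
qed

lemma is_characteristic_poly_binomial_seq:
  "is_characteristic_poly (binomial_seq k) ([:-1, 1:] ^ (k + 1))"
  unfolding is_characteristic_poly_def
proof (intro conjI ballI impI)
  show "lead_coeff ([:-1, 1:] ^ (k + 1) :: 'a mod_ring poly) = 1"
    by (rule monic_power) simp
  show "degree ([:-1, 1:] ^ (k + 1) :: 'a mod_ring poly) \<le> degree r"
    if "r \<in> generating_polys (binomial_seq k)" "r \<noteq> 0" for r :: "'a mod_ring poly"
    using degree_generating_poly_binomial_seq[OF that] by (simp only: degree_linear_power)
qed (rule power_in_generating_polys_binomial_seq)

theorem theorem16:
  fixes k :: nat
  defines "s \<equiv> (binomial_seq k :: nat \<Rightarrow> 'p::prime_card mod_ring)"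
  shows "generating_polys s \<noteq> {0} \<and>
         characteristic_poly s = [:-1, 1:] ^ (k + 1) \<and>
         linear_complexity s = k + 1"
proof -
  have char: "is_characteristic_poly s ([:-1, 1:] ^ (k + 1))"
    unfolding s_def by (rule is_characteristic_poly_binomial_seq)
  \<comment> \<open>A nonzero element of the ideal ensures that the \<open>THE\<close> in
    \<open>characteristic_poly\<close> has a unique referent.\<close>
  have "[:-1, 1:] ^ (k + 1) \<noteq> (0 :: 'p mod_ring poly)"
    by (simp only: power_eq_0_iff) simp
  with char have nontrivial: "generating_polys s \<noteq> {0}"
    unfolding is_characteristic_poly_def by blast
  then have eq: "characteristic_poly s = [:-1, 1:] ^ (k + 1)"
    unfolding characteristic_poly_def
    using char by (intro the1_equality ex1_characteristic_poly)
  then have "linear_complexity s = k + 1"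
    unfolding linear_complexity_def by (simp only: degree_linear_power)
  with nontrivial eq show ?thesis
    by blast
qed

end
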